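(* Let $H$ be a reproducing kernel Hilbert space on a set $X$ with a complete Nevanlinna-Pick kernel $K$, and suppose there is a point $\omega\in X$ such that $K(\omega,x)=K(x,\omega)=1$ for all $x\in X$. Let $J$ be any closed multiplier invariant subspace of $H$, and let $J^{\perp}$ be its orthogonal complement in $H$. Then for all $x,y\in X$ $$\delta_J(x,y)\ \ge\ \delta_H(x,y)\ \ge\ \delta_{J^{\perp}}(x,y),$$ where each of the two inequalities is asserted for those $x,y$ for which both of its sides are defined.
   Context: A reproducing kernel Hilbert space (RKHS) $H$ on $X$ is a complex Hilbert space of functions on $X$ with a function $K$ on $X\times X$ such that $k_x=K(\cdot,x)\in H$ and $\langle f,k_x\rangle=f(x)$ for all $f\in H$, $x\in X$. The distance function of $H$ is $$\delta_H(x,y)=\sqrt{1-\frac{|\langle k_x,k_y\rangle|^2}{\|k_x\|^2\|k_y\|^2}},$$ defined when $k_x\neq0$ and $k_y\neq0$ and left undefined otherwise. Closed subspaces of $H$ (such as $J$ and $J^\perp$) are RKHSs on $X$ with the inherited inner product, and $\delta_J$, $\delta_{J^\perp}$ are defined by the same formula using their own reproducing kernels. $H$ has a complete Nevanlinna-Pick kernel if there are functions $\{b_i\}_{i=1}^\infty$ on $X$ with $1-\frac{1}{K(x,y)}=\sum_{i=1}^\infty b_i(x)\overline{b_i(y)}$ for all $x,y\in X$ (in particular $K$ is nonvanishing). A multiplier of $H$ is a function $m$ on $X$ such that $f\mapsto mf$ is a bounded map of $H$ to itself; a subspace $J$ is multiplier invariant if $mj\in J$ for every $j\in J$ and every multiplier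 $m$ of $H$. *)

theory Defs
  imports "HOL-Analysis.Analysis" "HOL-Library.Function_Algebras"
begin

text \<open>
  The set on which the functions live is the type \<open>'x\<close>. A space of functions is given by its
  carrier \<open>H\<close> together with an inner product \<open>ip\<close>, linear in its first argument, about which
  nothing is assumed outside of \<open>H\<close>. Sums, differences and products of functions are the
  pointwise ones of \<^theory>\<open>HOL-Library.Function_Algebras\<close>.
\<close>

locale linear_function_space =
  fixes H :: "('x \<Rightarrow> complex) set"
  assumes zero_in: "0 \<in> H"
    and add_in: "\<lbrakk>f \<in> H; g \<in> H\<rbrakk> \<Longrightarrow> f + g \<in> H"
    and scale_in: "f \<in> H \<Longrightarrow> (\<lambda>t. c * f t) \<in> H"

locale inner_function_space = linear_function_space H
  for H :: "('x \<Rightarrow> complex) set" +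
  fixes ip :: "('x \<Rightarrow> complex) \<Rightarrow> ('x \<Rightarrow> complex) \<Rightarrow> complex"
  assumes ip_add_left: "\<lbrakk>f \<in> H; g \<in> H; h \<in> H\<rbrakk> \<Longrightarrow> ip (f + g) h = ip f h + ip g h"
    and ip_scale_left: "\<lbrakk>f \<in> H; h \<in> H\<rbrakk> \<Longrightarrow> ip (\<lambda>t. c * f t) h = c * ip f h"
    and ip_commute: "\<lbrakk>f \<in> H; g \<in> H\<rbrakk> \<Longrightarrow> ip f g = cnj (ip g f)"
    and ip_self_nonneg: "f \<in> H \<Longrightarrow> 0 \<le> Re (ip f f)"
    and ip_self_eq_0: "\<lbrakk>f \<in> H; ip f f = 0\<rbrakk> \<Longrightarrow> f = 0"

definition ip_norm ::
    "(('x \<Rightarrow> complex) \<Rightarrow> ('x \<Rightarrow> complex) \<Rightarrow> complex) \<Rightarrow> ('x \<Rightarrow> complex) \<Rightarrow> real"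
  where "ip_norm ip f = sqrt (Re (ip f f))"

text \<open>
  The norm distance on \<open>H\<close>. It is set to 0 off \<open>H\<close>, since \<^locale>\<open>Metric_space\<close> requires
  nonnegativity and symmetry on the whole type.
\<close>

definition ip_dist :: "('x \<Rightarrow> complex) set \<Rightarrow>
    (('x \<Rightarrow> complex) \<Rightarrow> ('x \<Rightarrow> complex) \<Rightarrow> complex) \<Rightarrow>
    ('x \<Rightarrow> complex) \<Rightarrow> ('x \<Rightarrow> complex) \<Rightarrow> real"
  where "ip_dist H ip f g = (if f \<in> H \<and> g \<in> H then ip_norm ip (f - g) else 0)"

context inner_function_space
begin

lemma uminus_eq_scale: "- f = (\<lambda>t. (- 1) * f t)" for f :: "'x \<Rightarrow> complex"
  by (simp add: fun_eq_iff)

lemma uminus_in: "f \<in> H \<Longrightarrow> - f \<in> H"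
  using scale_in[of f "- 1"] by (simp only: uminus_eq_scale)

lemma diff_in: "\<lbrakk>f \<in> H; g \<in> H\<rbrakk> \<Longrightarrow> f - g \<in> H"
  using add_in[of f "- g"] uminus_in by simp

lemma ip_add_right: "\<lbrakk>f \<in> H; g \<in> H; h \<in> H\<rbrakk> \<Longrightarrow> ip h (f + g) = ip h f + ip h g"
  by (metis add_in complex_cnj_add ip_add_left ip_commute)

lemma ip_scale_right: "\<lbrakk>f \<in> H; h \<in> H\<rbrakk> \<Longrightarrow> ip h (\<lambda>t. c * f t) = cnj c * ip h f"
  by (metis complex_cnj_mult ip_commute ip_scale_left scale_in)

lemma ip_uminus_left: "\<lbrakk>f \<in> H; h \<in> H\<rbrakk> \<Longrightarrow> ip (- f) h = - ip f h"
  using ip_scale_left[of f h "- 1"] by (simp only: uminus_eq_scale) simp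

lemma ip_diff_left: "\<lbrakk>f \<in> H; g \<in> H; h \<in> H\<rbrakk> \<Longrightarrow> ip (f - g) h = ip f h - ip g h"
  using ip_add_left[of f "- g" h] ip_uminus_left uminus_in by simp

lemma ip_diff_right: "\<lbrakk>f \<in> H; g \<in> H; h \<in> H\<rbrakk> \<Longrightarrow> ip h (f - g) = ip h f - ip h g"
  by (metis complex_cnj_diff diff_in ip_commute ip_diff_left)

lemma ip_zero_left: "h \<in> H \<Longrightarrow> ip 0 h = 0"
  using ip_diff_left[of h h h] by simp

lemma ip_self_real: "f \<in> H \<Longrightarrow> ip f f = of_real (Re (ip f f))"
  using ip_commute[of f f] by (simp add: complex_eq_iff)

lemma ip_norm_nonneg: "f \<in> H \<Longrightarrow> 0 \<le> ip_norm ip f"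
  by (simp add: ip_norm_def ip_self_nonneg)

lemma ip_norm_power2: "f \<in> H \<Longrightarrow> (ip_norm ip f)\<^sup>2 = Re (ip f f)"
  by (simp add: ip_norm_def ip_self_nonneg)

lemma ip_norm_eq_0: "f \<in> H \<Longrightarrow> ip_norm ip f = 0 \<longleftrightarrow> f = 0"
  by (metis ip_norm_def ip_self_eq_0 ip_self_real ip_zero_left of_real_0 real_sqrt_eq_zero_cancel_iff
      real_sqrt_zero zero_complex.sel(1))

lemma Re_ip_le:
  assumes f: "f \<in> H" and g: "g \<in> H"
  shows "Re (ip f g) \<le> ip_norm ip f * ip_norm ip g"
proof -
  let ?a = "ip_norm ip f" and ?b = "ip_norm ip g"
  define u where "u = (\<lambda>t. of_real ?b * f t)"
  define v where "v = (\<lambda>t. of_real ?a * g t)"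
  have uv: "u \<in> H" "v \<in> H" by (simp_all add: u_def v_def scale_in f g)
  have "Re (ip u u) = ?b\<^sup>2 * ?a\<^sup>2"
    using f by (simp add: u_def ip_scale_left ip_scale_right scale_in flip: ip_norm_power2)
      (simp add: power2_eq_square)
  moreover have "Re (ip v v) = ?b\<^sup>2 * ?a\<^sup>2"
    using g by (simp add: v_def ip_scale_left ip_scale_right scale_in flip: ip_norm_power2)
      (simp add: power2_eq_square)
  moreover have "Re (ip u v) = ?a * ?b * Re (ip f g)"
    using f g by (simp add: u_def v_def ip_scale_left ip_scale_right scale_in)
  moreover have "Re (ip v u) = Re (ip u v)"
    by (simp add: ip_commute[OF uv])
  moreover have "0 \<le> Re (ip (u - v) (u - v))"
    by (rule ip_self_nonneg[OF diff_in[OF uv]])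
  ultimately have le: "?a * ?b * Re (ip f g) \<le> (?a * ?b) * (?a * ?b)"
    using uv by (simp add: ip_diff_left ip_diff_right diff_in power2_eq_square mult_ac)
  show ?thesis
  proof (cases "?a * ?b = 0")
    case True
    then have "f = 0 \<or> g = 0" using f g by (simp add: ip_norm_eq_0)
    then have "ip f g = 0" using f g ip_zero_left ip_commute by (metis complex_cnj_zero)
    then show ?thesis using f g by (simp add: ip_norm_nonneg)
  next
    case False
    then have "0 < ?a * ?b"
      using f g ip_norm_nonneg by (metis less_eq_real_def mult_nonneg_nonneg)
    then show ?thesis using le by (simp only: mult_le_cancel_left_pos)
  qed
qed

lemma ip_norm_triangle:
  assumes f: "f \<in> H" and g: "g \<in> H"
  shows "ip_norm ip (f + g) \<le> ip_norm ip f + ip_norm ip g"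
proof (rule power2_le_imp_le)
  have "Re (ip g f) = Re (ip f g)" using ip_commute[OF f g] by simp
  then show "(ip_norm ip (f + g))\<^sup>2 \<le> (ip_norm ip f + ip_norm ip g)\<^sup>2"
    using f g Re_ip_le[OF f g]
    by (simp add: ip_norm_power2 add_in ip_add_left ip_add_right power2_sum)
  show "0 \<le> ip_norm ip f + ip_norm ip g"
    using f g by (simp add: ip_norm_nonneg)
qed

lemma ip_norm_uminus: "f \<in> H \<Longrightarrow> ip_norm ip (- f) = ip_norm ip f"
  using ip_commute[of f "- f"]
  by (simp add: ip_norm_def ip_uminus_left uminus_in)

sublocale Metric_space H "ip_dist H ip"
proof
  fix f g h :: "'x \<Rightarrow> complex"
  show "0 \<le> ip_dist H ip f g"
    by (simp add: ip_dist_def ip_norm_nonneg diff_in)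
  show "ip_dist H ip f g = ip_dist H ip g f"
    using ip_norm_uminus[of "f - g"] by (auto simp: ip_dist_def diff_in)
  show "ip_dist H ip f g = 0 \<longleftrightarrow> f = g" if "f \<in> H" "g \<in> H"
    using that by (simp add: ip_dist_def ip_norm_eq_0 diff_in)
  show "ip_dist H ip f h \<le> ip_dist H ip f g + ip_dist H ip g h"
    if "f \<in> H" "g \<in> H" "h \<in> H"
    using that ip_norm_triangle[of "f - g" "g - h"] by (simp add: ip_dist_def diff_in)
qed

end

locale hilbert_function_space = inner_function_space +
  assumes complete: "Metric_space.mcomplete H (ip_dist H ip)"

locale rkhs = hilbert_function_space H ip
  for H :: "('x \<Rightarrow> complex) set" and ip +
  fixes K :: "'x \<Rightarrow> 'x \<Rightarrow> complex"
  assumes kernel_in: "(\<lambda>t. K t x) \<in> H"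
    and reproducing: "f \<in> H \<Longrightarrow> ip f (\<lambda>t. K t x) = f x"

definition reproducing_kernel :: "('x \<Rightarrow> complex) set \<Rightarrow>
    (('x \<Rightarrow> complex) \<Rightarrow> ('x \<Rightarrow> complex) \<Rightarrow> complex) \<Rightarrow> 'x \<Rightarrow> 'x \<Rightarrow> complex"
  where "reproducing_kernel H ip = (THE K. rkhs H ip K)"

lemma (in rkhs) reproducing_kernel_eq: "reproducing_kernel H ip = K"
  unfolding reproducing_kernel_def
proof (rule the_equality)
  show "rkhs H ip K" by (rule rkhs_axioms)
next
  fix L assume "rkhs H ip L"
  then interpret L: rkhs H ip L .
  show "L = K"
  proof (intro ext)
    fix y x
    have "L y x = ip (\<lambda>t. L t x) (\<lambda>t. K t y)"
      by (simp add: reproducing L.kernel_in)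
    also have "\<dots> = cnj (ip (\<lambda>t. K t y) (\<lambda>t. L t x))"
      by (rule ip_commute[OF L.kernel_in kernel_in])
    also have "\<dots> = cnj (ip (\<lambda>t. K t y) (\<lambda>t. K t x))"
      by (simp only: L.reproducing[OF kernel_in] reproducing[OF kernel_in])
    also have "\<dots> = ip (\<lambda>t. K t x) (\<lambda>t. K t y)"
      by (rule ip_commute[OF kernel_in kernel_in, symmetric])
    also have "\<dots> = K y x"
      by (simp add: reproducing kernel_in)
    finally show "L y x = K y x" .
  qed
qed

definition kernel_fun :: "('x \<Rightarrow> complex) set \<Rightarrow>
    (('x \<Rightarrow> complex) \<Rightarrow> ('x \<Rightarrow> complex) \<Rightarrow> complex) \<Rightarrow> 'x \<Rightarrow> 'x \<Rightarrow> complex"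
  where "kernel_fun H ip x = (\<lambda>t. reproducing_kernel H ip t x)"

definition rk_dist_defined :: "('x \<Rightarrow> complex) set \<Rightarrow>
    (('x \<Rightarrow> complex) \<Rightarrow> ('x \<Rightarrow> complex) \<Rightarrow> complex) \<Rightarrow> 'x \<Rightarrow> 'x \<Rightarrow> bool"
  where "rk_dist_defined H ip x y \<longleftrightarrow> kernel_fun H ip x \<noteq> 0 \<and> kernel_fun H ip y \<noteq> 0"

text \<open>Meaningful only where \<^const>\<open>rk_dist_defined\<close> holds.\<close>

definition rk_dist :: "('x \<Rightarrow> complex) set \<Rightarrow>
    (('x \<Rightarrow> complex) \<Rightarrow> ('x \<Rightarrow> complex) \<Rightarrow> complex) \<Rightarrow> 'x \<Rightarrow> 'x \<Rightarrow> real"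
  where "rk_dist H ip x y =
    sqrt (1 - (cmod (ip (kernel_fun H ip x) (kernel_fun H ip y)))\<^sup>2 /
              ((ip_norm ip (kernel_fun H ip x))\<^sup>2 * (ip_norm ip (kernel_fun H ip y))\<^sup>2))"

definition complete_pick_kernel :: "('x \<Rightarrow> 'x \<Rightarrow> complex) \<Rightarrow> bool"
  where "complete_pick_kernel K \<longleftrightarrow> (\<forall>x y. K x y \<noteq> 0) \<and>
    (\<exists>b :: nat \<Rightarrow> 'x \<Rightarrow> complex. \<forall>x y. (\<lambda>i. b i x * cnj (b i y)) sums (1 - 1 / K x y))"

definition multiplier :: "('x \<Rightarrow> complex) set \<Rightarrow>
    (('x \<Rightarrow> complex) \<Rightarrow> ('x \<Rightarrow> complex) \<Rightarrow> complex) \<Rightarrow> ('x \<Rightarrow> complex) \<Rightarrow> bool"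
  where "multiplier H ip m \<longleftrightarrow> (\<forall>f\<in>H. m * f \<in> H) \<and>
    (\<exists>C. \<forall>f\<in>H. ip_norm ip (m * f) \<le> C * ip_norm ip f)"

definition multiplier_invariant :: "('x \<Rightarrow> complex) set \<Rightarrow>
    (('x \<Rightarrow> complex) \<Rightarrow> ('x \<Rightarrow> complex) \<Rightarrow> complex) \<Rightarrow> ('x \<Rightarrow> complex) set \<Rightarrow> bool"
  where "multiplier_invariant H ip J \<longleftrightarrow> (\<forall>m. multiplier H ip m \<longrightarrow> (\<forall>j\<in>J. m * j \<in> J))"

definition closed_subspace :: "('x \<Rightarrow> complex) set \<Rightarrow>
    (('x \<Rightarrow> complex) \<Rightarrow> ('x \<Rightarrow> complex) \<Rightarrow> complex) \<Rightarrow> ('x \<Rightarrow> complex) set \<Rightarrow> bool"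
  where "closed_subspace H ip J \<longleftrightarrow> J \<subseteq> H \<and> linear_function_space J \<and>
    closedin (Metric_space.mtopology H (ip_dist H ip)) J"

definition ortho_complement :: "('x \<Rightarrow> complex) set \<Rightarrow>
    (('x \<Rightarrow> complex) \<Rightarrow> ('x \<Rightarrow> complex) \<Rightarrow> complex) \<Rightarrow> ('x \<Rightarrow> complex) set \<Rightarrow>
    ('x \<Rightarrow> complex) set"
  where "ortho_complement H ip J = {f \<in> H. \<forall>j\<in>J. ip f j = 0}"

end

theory Submission
  imports Defs
begin

text \<open>
  Write \<open>K\<close> for the kernel of \<open>H\<close> and \<open>L\<close> for that of \<open>J\<close>, so that \<open>K - L\<close> is the kernel of the
  orthogonal complement. The identity \<open>K(x,y) (1 - \<Sum>i. b i x * cnj (b i y)) = 1\<close> makes the row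
  \<open>(b 0, b 1, \<dots>)\<close> a contraction from a direct sum of copies of \<open>H\<close> to \<open>H\<close>; it sends copies of \<open>J\<close>
  into \<open>J\<close> because each \<open>b i\<close> is a multiplier. Hence \<open>Q = L / K = L (1 - \<Sum>i. b i x * cnj (b i y))\<close>
  is positive definite, with \<open>Q(x,x) \<le> 1\<close>. As \<open>L = K Q\<close> and \<open>K - L = K (1 - Q)\<close>, the two inequalities
  are \<open>|Q(x,y)|\<^sup>2 \<le> Q(x,x) Q(y,y)\<close> and \<open>(1 - Q(x,x)) (1 - Q(y,y)) \<le> |1 - Q(x,y)|\<^sup>2\<close>.
\<close>

section \<open>Finite sums, Cauchy-Schwarz and continuity of the inner product\<close>

context linear_function_space
begin

lemma sum_in:
  assumes "finite A" "\<And>a. a \<in> A \<Longrightarrow> f a \<in> H"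
  shows "(\<lambda>t. \<Sum>a\<in>A. f a t) \<in> H"
  using assms
proof (induction rule: finite_induct)
  case empty
  then show ?case using zero_in by (simp add: zero_fun_def)
next
  case (insert a A)
  then show ?case using add_in[of "f a" "\<lambda>t. \<Sum>a\<in>A. f a t"] by (simp add: plus_fun_def)
qed

end

context inner_function_space
begin

lemma ip_sum_left:
  assumes "finite A" "\<And>a. a \<in> A \<Longrightarrow> f a \<in> H" "h \<in> H"
  shows "ip (\<lambda>t. \<Sum>a\<in>A. f a t) h = (\<Sum>a\<in>A. ip (f a) h)"
  using assms
proof (induction rule: finite_induct)
  case empty
  then show ?case using ip_zero_left by (simp add: zero_fun_def)
next
  case (insert a A)
  then show ?case
    using ip_add_left[of "f a" "\<lambda>t. \<Sum>a\<in>A. f a t" h] sum_in[of A f] by (simp add: plus_fun_def)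
qed

lemma ip_sum_right:
  assumes "finite A" "\<And>a. a \<in> A \<Longrightarrow> f a \<in> H" "h \<in> H"
  shows "ip h (\<lambda>t. \<Sum>a\<in>A. f a t) = (\<Sum>a\<in>A. ip h (f a))"
proof -
  have "ip h (\<lambda>t. \<Sum>a\<in>A. f a t) = cnj (\<Sum>a\<in>A. ip (f a) h)"
    using assms by (subst ip_commute) (auto simp: sum_in ip_sum_left)
  also have "\<dots> = (\<Sum>a\<in>A. ip h (f a))"
    using assms by (auto simp: intro!: sum.cong ip_commute[symmetric])
  finally show ?thesis .
qed

lemma ip_self: "f \<in> H \<Longrightarrow> ip f f = of_real ((ip_norm ip f)\<^sup>2)"
  using ip_self_real ip_norm_power2 by simp

lemma ip_norm_scale:
  assumes "f \<in> H"
  shows "ip_norm ip (\<lambda>t. c * f t) = cmod c * ip_norm ip f"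
proof -
  have "Re (ip (\<lambda>t. c * f t) (\<lambda>t. c * f t)) = (cmod c * ip_norm ip f)\<^sup>2"
    using assms by (simp add: ip_scale_left ip_scale_right scale_in ip_self power_mult_distrib
        flip: mult.assoc complex_norm_square)
  then show ?thesis
    using assms by (simp add: ip_norm_def[of ip "\<lambda>t. c * f t"] ip_norm_nonneg)
qed

lemma cmod_ip_le:
  assumes f: "f \<in> H" and g: "g \<in> H"
  shows "cmod (ip f g) \<le> ip_norm ip f * ip_norm ip g"
proof (cases "ip f g = 0")
  case True
  then show ?thesis using f g by (simp add: ip_norm_nonneg)
next
  case False
  \<comment> \<open>Multiplying \<open>f\<close> by the unimodular \<open>e\<close> rotates
    \<open>ip f g\<close> onto its modulus, so the bound on real parts suffices.\<close>
  define e where "e = cnj (ip f g) / cmod (ip f g)"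
  have e: "cmod e = 1" using False by (simp add: e_def norm_divide)
  have "e * ip f g = (ip f g * cnj (ip f g)) / cmod (ip f g)" by (simp add: e_def mult.commute)
  also have "\<dots> = cmod (ip f g)"
    using False by (simp add: complex_norm_square[symmetric] power2_eq_square)
  finally have "e * ip f g = cmod (ip f g)" .
  then have "cmod (ip f g) = Re (ip (\<lambda>t. e * f t) g)"
    using f g by (simp add: ip_scale_left)
  also have "\<dots> \<le> ip_norm ip (\<lambda>t. e * f t) * ip_norm ip g"
    using f g by (intro Re_ip_le scale_in)
  also have "\<dots> = ip_norm ip f * ip_norm ip g" using f e by (simp add: ip_norm_scale)
  finally show ?thesis .
qed

lemma tendsto_ip_left:
  assumes "\<And>n. F n \<in> H" "u \<in> H" "g \<in> H" "(\<lambda>n. ip_norm ip (F n - u)) \<longlonglongrightarrow> 0"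
  shows "(\<lambda>n. ip (F n) g) \<longlonglongrightarrow> ip u g"
proof (rule LIM_zero_cancel, rule Lim_null_comparison)
  show "\<forall>\<^sub>F n in sequentially. cmod (ip (F n) g - ip u g) \<le> ip_norm ip (F n - u) * ip_norm ip g"
    using assms cmod_ip_le by (simp add: diff_in flip: ip_diff_left)
  show "(\<lambda>n. ip_norm ip (F n - u) * ip_norm ip g) \<longlonglongrightarrow> 0"
    using tendsto_mult_left_zero[OF assms(4)] .
qed

lemma tendsto_ip_norm:
  assumes "\<And>n. F n \<in> H" "u \<in> H" "(\<lambda>n. ip_norm ip (F n - u)) \<longlonglongrightarrow> 0"
  shows "(\<lambda>n. ip_norm ip (F n)) \<longlonglongrightarrow> ip_norm ip u"
proof (rule LIM_zero_cancel, rule Lim_null_comparison)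
  have "\<bar>ip_norm ip (F n) - ip_norm ip u\<bar> \<le> ip_norm ip (F n - u)" for n
    using assms ip_norm_triangle[of "F n - u" u] ip_norm_triangle[of "- (F n - u)" "F n"]
      ip_norm_uminus[of "F n - u"] uminus_in[of "F n - u"] by (simp add: diff_in)
  then show "\<forall>\<^sub>F n in sequentially. norm (ip_norm ip (F n) - ip_norm ip u) \<le> ip_norm ip (F n - u)"
    by simp
qed (rule assms(3))

lemma subspace_inner:
  assumes "J \<subseteq> H" "linear_function_space J"
  shows "inner_function_space J ip"
proof -
  interpret J: linear_function_space J by fact
  show ?thesis
    using assms(1)
    by unfold_locales (auto simp: subset_iff ip_add_left ip_scale_left ip_self_nonneg ip_self_eq_0
        intro: ip_commute)
qed

lemma limitin_iff:
  assumes "\<And>n. F n \<in> H"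
  shows "limitin mtopology F u sequentially \<longleftrightarrow>
    u \<in> H \<and> (\<lambda>n. ip_norm ip (F n - u)) \<longlonglongrightarrow> 0"
  using assms by (auto simp: limitin_metric_dist_null ip_dist_def)

text \<open>Orthogonality to a fixed \<open>j\<close> survives norm limits because \<open>ip\<close>
  is continuous in its left argument.\<close>

lemma ortho_complement_closed_subspace:
  assumes "J \<subseteq> H"
  shows "closed_subspace H ip (ortho_complement H ip J)"
  unfolding closed_subspace_def metric_closedin_iff_sequentially_closed
proof (intro conjI allI impI)
  show "linear_function_space (ortho_complement H ip J)"
    using assms by unfold_locales
      (auto simp: ortho_complement_def zero_in add_in scale_in ip_zero_left ip_add_left
        ip_scale_left subset_iff)
next
  fix F u assume "range F \<subseteq> ortho_complement H ip J \<and> limitin mtopology F u sequentially"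
  then have lim: "limitin mtopology F u sequentially" and "\<And>n. F n \<in> ortho_complement H ip J"
    by auto
  then have F: "F n \<in> H" "j \<in> J \<Longrightarrow> ip (F n) j = 0" for n j
    by (auto simp: ortho_complement_def)
  have u: "u \<in> H" "(\<lambda>n. ip_norm ip (F n - u)) \<longlonglongrightarrow> 0"
    using lim F(1) by (auto simp: limitin_iff)
  have "ip u j = 0" if "j \<in> J" for j
    using tendsto_ip_left[OF F(1) u(1) _ u(2), of j] that assms F(2)
    by (auto simp: LIMSEQ_const_iff)
  then show "u \<in> ortho_complement H ip J" using u by (simp add: ortho_complement_def)
qed (auto simp: ortho_complement_def)

end

section \<open>Riesz representation and completeness of closed subspaces\<close>

context hilbert_function_space
begin

lemma Cauchy_limit:
  assumes "\<And>n. F n \<in> H"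
    and "\<And>e. 0 < e \<Longrightarrow> \<exists>N. \<forall>m\<ge>N. \<forall>n\<ge>N. ip_norm ip (F m - F n) < e"
  obtains u where "u \<in> H" "(\<lambda>n. ip_norm ip (F n - u)) \<longlonglongrightarrow> 0"
proof -
  have "MCauchy F"
    using assms unfolding MCauchy_def by (auto simp: ip_dist_def)
  then obtain u where u: "limitin mtopology F u sequentially"
    using complete unfolding mcomplete_def by blast
  then have uH: "u \<in> H" by (simp add: limitin_metric)
  have "(\<lambda>n. ip_dist H ip (F n) u) \<longlonglongrightarrow> 0"
    using u by (simp add: limitin_metric_dist_null)
  then show thesis using that uH assms(1) by (simp add: ip_dist_def)
qed

text \<open>
  \<open>R\<close> is the graph of a bounded linear functional on a subspace; the representing vector is the
  limit of a minimising sequence of \<open>\<parallel>f\<parallel>\<^sup>2 - 2 Re l\<close>. Using a graph avoids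
  showing separately that the functional is well defined.
\<close>

lemma riesz_graph:
  assumes R0: "(0, 0) \<in> R"
    and R_add: "\<And>f l g m. \<lbrakk>(f, l) \<in> R; (g, m) \<in> R\<rbrakk> \<Longrightarrow> (f + g, l + m) \<in> R"
    and R_scale: "\<And>f l c. (f, l) \<in> R \<Longrightarrow> ((\<lambda>t. c * f t), c * l) \<in> R"
    and R_in: "\<And>f l. (f, l) \<in> R \<Longrightarrow> f \<in> H"
    and bound: "\<And>f l. (f, l) \<in> R \<Longrightarrow> cmod l \<le> C * ip_norm ip f"
    and C: "0 \<le> C"
  obtains u where "u \<in> H" "ip_norm ip u \<le> C" "\<And>f l. (f, l) \<in> R \<Longrightarrow> ip f u = l"
proof -
  define \<Phi> :: "('a \<Rightarrow> complex) \<times> complex \<Rightarrow> real"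
    where "\<Phi> = (\<lambda>(f, l). Re (ip f f) - 2 * Re l)"
  define s where "s = (INF p\<in>R. \<Phi> p)"
  \<comment> \<open>The bound on \<open>l\<close> gives \<Phi> at least
    \<open>(ip_norm ip f)\<^sup>2 - 2 * C * ip_norm ip f\<close>; completing the square does the
    rest.\<close>
  have "- C\<^sup>2 \<le> \<Phi> p" if "p \<in> R" for p
  proof -
    obtain f l where p: "p = (f, l)" by fastforce
    have "Re l \<le> C * ip_norm ip f" using bound[of f l] that p complex_Re_le_cmod[of l] by simp
    moreover have "0 \<le> (ip_norm ip f - C)\<^sup>2" by simp
    ultimately show ?thesis using R_in[of f l] that
      by (simp add: \<Phi>_def p power2_diff mult.commute flip: ip_norm_power2)
  qed
  then have bdd: "bdd_below (\<Phi> ` R)" by (intro bdd_belowI2)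
  have s_le: "s \<le> \<Phi> p" if "p \<in> R" for p
    unfolding s_def using bdd that by (rule cINF_lower)
  have "\<exists>p\<in>R. \<Phi> p < s + 1 / real (Suc n)" for n
  proof -
    have "s < s + 1 / real (Suc n)" by simp
    then show ?thesis using R0 bdd unfolding s_def by (subst (asm) cINF_less_iff) auto
  qed
  then obtain p where p: "\<And>n. p n \<in> R" "\<And>n. \<Phi> (p n) < s + 1 / real (Suc n)" by metis
  define F where "F n = fst (p n)" for n
  define L where "L n = snd (p n)" for n
  have FL: "(F n, L n) \<in> R" for n using p by (simp add: F_def L_def)
  have \<Phi>_FL: "\<Phi> (F n, L n) < s + 1 / real (Suc n)" for n using p by (simp add: F_def L_def)
  have F: "F n \<in> H" for n using FL R_in by blast
  \<comment> \<open>Parallelogram law: the midpoint of two nearly minimal pairs is again in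
    \<open>R\<close>, so \<Phi> is at least \<open>s\<close> there, which leaves little room for the
    difference.\<close>
  have gap: "(ip_norm ip (F m - F n))\<^sup>2 \<le> 2 / real (Suc m) + 2 / real (Suc n)" for m n
  proof -
    have half: "ip (\<lambda>t. (1/2) * G t) (\<lambda>t. (1/2) * G t) = ip G G / 4" if "G \<in> H" for G
      using that by (simp only: ip_scale_left ip_scale_right scale_in) simp
    have "((\<lambda>t. (1/2) * (F m + F n) t), (1/2) * (L m + L n)) \<in> R"
      by (intro R_scale R_add FL)
    then have "s \<le> \<Phi> ((\<lambda>t. (1/2) * (F m + F n) t), (1/2) * (L m + L n))" by (rule s_le)
    also have "\<dots> = Re (ip (F m + F n) (F m + F n)) / 4 - Re (L m) - Re (L n)"
      by (simp only: \<Phi>_def prod.case half[OF add_in[OF F F]]) (simp add: add_divide_distrib)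
    finally have "4 * s \<le> Re (ip (F m + F n) (F m + F n)) - 4 * Re (L m) - 4 * Re (L n)" by simp
    moreover have "Re (ip (F m - F n) (F m - F n)) + Re (ip (F m + F n) (F m + F n))
        = 2 * Re (ip (F m) (F m)) + 2 * Re (ip (F n) (F n))"
      using F by (simp add: ip_diff_left ip_diff_right ip_add_left ip_add_right add_in diff_in)
    moreover have "Re (ip (F k) (F k)) < s + 2 * Re (L k) + 1 / real (Suc k)" for k
      using \<Phi>_FL[of k] by (simp add: \<Phi>_def)
    from this[of m] this[of n]
    have "Re (ip (F m) (F m)) + Re (ip (F n) (F n)) \<le>
       2 * s + 2 * Re (L m) + 2 * Re (L n) + 1 / real (Suc m) + 1 / real (Suc n)" by linarith
    ultimately have "Re (ip (F m - F n) (F m - F n)) \<le> 2 * (1 / real (Suc m)) + 2 * (1 / real (Suc n))"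
      by linarith
    then show ?thesis using F by (simp add: ip_norm_power2 diff_in)
  qed
  have "\<exists>N. \<forall>m\<ge>N. \<forall>n\<ge>N. ip_norm ip (F m - F n) < e" if "0 < e" for e
  proof -
    obtain N where N: "4 / e\<^sup>2 < real N" using reals_Archimedean2 by blast
    have "ip_norm ip (F m - F n) < e" if mn: "m \<ge> N" "n \<ge> N" for m n
    proof (rule power2_less_imp_less)
      have *: "2 / real (Suc k) < e\<^sup>2 / 2" if "k \<ge> N" for k
      proof -
        have "4 / e\<^sup>2 < real (Suc k)" using N that by linarith
        then show ?thesis using \<open>0 < e\<close> by (simp add: field_simps)
      qed
      show "(ip_norm ip (F m - F n))\<^sup>2 < e\<^sup>2"
        using gap[of m n] *[OF mn(1)] *[OF mn(2)] by linarith
    qed (use \<open>0 < e\<close> in simp)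
    then show ?thesis by blast
  qed
  then obtain u where u: "u \<in> H" "(\<lambda>n. ip_norm ip (F n - u)) \<longlonglongrightarrow> 0"
    using Cauchy_limit[of F] F by blast
  have rep: "ip f u = l" if fl: "(f, l) \<in> R" for f l
  proof -
    have f: "f \<in> H" using fl by (rule R_in)
    \<comment> \<open>First variation at the minimiser. The perturbation is made at
      \<open>F n\<close>, which is known to occur in \<open>R\<close>, and only then does
      \<open>n\<close> tend to infinity.\<close>
    have pert: "0 \<le> 2 * Re (t * (cnj (ip u f) - l)) + (cmod t)\<^sup>2 * (ip_norm ip f)\<^sup>2" for t
    proof -
      have "0 \<le> 1 / real (Suc n) + 2 * Re (t * (cnj (ip (F n) f) - l))
          + (cmod t)\<^sup>2 * (ip_norm ip f)\<^sup>2" for n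
      proof -
        have tf: "(\<lambda>x. t * f x) \<in> H" using f by (rule scale_in)
        have "s \<le> \<Phi> (F n + (\<lambda>x. t * f x), L n + t * l)"
          by (intro s_le R_add R_scale FL fl)
        also have "\<dots> = \<Phi> (F n, L n) + Re (ip (F n) (\<lambda>x. t * f x)) + Re (ip (\<lambda>x. t * f x) (F n))
            + (ip_norm ip (\<lambda>x. t * f x))\<^sup>2 - 2 * Re (t * l)"
          using F tf by (simp add: \<Phi>_def ip_add_left ip_add_right add_in ip_norm_power2)
        also have "ip (F n) (\<lambda>x. t * f x) = cnj (ip (\<lambda>x. t * f x) (F n))"
          by (rule ip_commute[OF F tf])
        also have "ip (\<lambda>x. t * f x) (F n) = t * cnj (ip (F n) f)"
          using F f by (simp add: ip_scale_left flip: ip_commute)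
        also have "ip_norm ip (\<lambda>x. t * f x) = cmod t * ip_norm ip f"
          using f by (rule ip_norm_scale)
        finally show ?thesis using \<Phi>_FL[of n] by (simp add: power_mult_distrib algebra_simps)
      qed
      moreover have "(\<lambda>n. 1 / real (Suc n) + 2 * Re (t * (cnj (ip (F n) f) - l))
          + (cmod t)\<^sup>2 * (ip_norm ip f)\<^sup>2)
        \<longlonglongrightarrow> 0 + 2 * Re (t * (cnj (ip u f) - l)) + (cmod t)\<^sup>2 * (ip_norm ip f)\<^sup>2"
        by (intro tendsto_add tendsto_mult tendsto_Re tendsto_diff tendsto_const
            LIMSEQ_Suc[OF lim_inverse_n'] tendsto_cnj tendsto_ip_left[OF F u(1) f u(2)])
      ultimately show ?thesis by (intro LIMSEQ_le_const[where a = 0]) auto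
    qed
    define w where "w = cnj (ip u f) - l"
    \<comment> \<open>For \<open>t = - \<epsilon> * cnj w\<close> the negative linear term outweighs
      the quadratic one unless \<open>w = 0\<close>. The summand 1 in the denominator covers
      \<open>f = 0\<close>.\<close>
    define \<epsilon> where "\<epsilon> = 1 / (1 + (ip_norm ip f)\<^sup>2)"
    have pos: "0 < 1 + (ip_norm ip f)\<^sup>2" by (rule add_pos_nonneg) auto
    then have \<epsilon>: "0 < \<epsilon>" "\<epsilon> * (ip_norm ip f)\<^sup>2 < 1" by (simp_all add: \<epsilon>_def)
    have "Re (- of_real \<epsilon> * cnj w * w) = - \<epsilon> * (cmod w)\<^sup>2"
      by (simp add: cmod_power2) (simp add: power2_eq_square algebra_simps)
    moreover have "cmod (- of_real \<epsilon> * cnj w) = \<epsilon> * cmod w" using \<epsilon> by (simp add: norm_mult)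
    ultimately have "0 \<le> - (2 * \<epsilon> * (cmod w)\<^sup>2) + (\<epsilon> * cmod w)\<^sup>2 * (ip_norm ip f)\<^sup>2"
      using pert[of "- of_real \<epsilon> * cnj w"] unfolding w_def[symmetric] by simp
    then have "0 \<le> \<epsilon> * ((cmod w)\<^sup>2 * (\<epsilon> * (ip_norm ip f)\<^sup>2 - 2))"
      by (simp add: power2_eq_square algebra_simps)
    then have "0 \<le> (cmod w)\<^sup>2 * (\<epsilon> * (ip_norm ip f)\<^sup>2 - 2)"
      using \<epsilon>(1) by (simp add: zero_le_mult_iff)
    then have "w = 0" using \<epsilon>(2) by (auto simp: zero_le_mult_iff)
    then show ?thesis using ip_commute[OF f u(1)] by (simp add: w_def)
  qed
  \<comment> \<open>Along the minimising sequence \<open>ip (F n) u\<close> equals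
    \<open>L n\<close>, so \<open>bound\<close> applies before passing to the limit.\<close>
  have "(ip_norm ip u)\<^sup>2 \<le> C * ip_norm ip u"
  proof (rule LIMSEQ_le)
    show "(\<lambda>n. cmod (ip (F n) u)) \<longlonglongrightarrow> (ip_norm ip u)\<^sup>2"
      using tendsto_norm[OF tendsto_ip_left[OF F u(1) u(1) u(2)]] u(1) by (simp add: ip_self norm_power ip_norm_nonneg)
    show "(\<lambda>n. C * ip_norm ip (F n)) \<longlonglongrightarrow> C * ip_norm ip u"
      by (intro tendsto_intros tendsto_ip_norm F u)
    show "\<exists>N. \<forall>n\<ge>N. cmod (ip (F n) u) \<le> C * ip_norm ip (F n)"
      using rep[OF FL] bound[OF FL] by auto
  qed
  then have "ip_norm ip u \<le> C"
    using C ip_norm_nonneg[OF u(1)] by (cases "ip_norm ip u = 0") (auto simp: power2_eq_square)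
  then show thesis using that u(1) rep by blast
qed

text \<open>A Cauchy sequence in \<open>J\<close> converges in \<open>H\<close>, and closedness puts
  its limit into \<open>J\<close>; the distances of \<open>H\<close> and \<open>J\<close> agree on
  \<open>J\<close>.\<close>

lemma closed_subspace_hilbert:
  assumes "closed_subspace H ip J"
  shows "hilbert_function_space J ip"
proof -
  have J: "J \<subseteq> H" "linear_function_space J" "closedin mtopology J"
    using assms by (auto simp: closed_subspace_def)
  interpret J: inner_function_space J ip using J by (intro subspace_inner)
  show ?thesis
  proof
    show "J.mcomplete" unfolding J.mcomplete_def
    proof (intro allI impI)
      fix F assume F: "J.MCauchy F"
      then have FJ: "F n \<in> J" for n by (auto simp: J.MCauchy_def)
      then have FH: "F n \<in> H" for n using J by blast
      have "\<exists>N. \<forall>m\<ge>N. \<forall>n\<ge>N. ip_norm ip (F m - F n) < e" if "0 < e" for e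
        using F that FJ unfolding J.MCauchy_def by (auto simp: ip_dist_def)
      then obtain u where u: "u \<in> H" "(\<lambda>n. ip_norm ip (F n - u)) \<longlonglongrightarrow> 0"
        using Cauchy_limit[of F] FH by blast
      then have "u \<in> J"
        using J(3) FJ limitin_iff[of F u, OF FH]
        by (auto simp: metric_closedin_iff_sequentially_closed image_subset_iff)
      then show "\<exists>u. limitin J.mtopology F u sequentially"
        using u FJ by (auto simp: J.limitin_iff)
    qed
  qed
qed

text \<open>The Riesz vector of evaluation at \<open>x\<close> serves as the kernel function at
  \<open>x\<close>.\<close>

lemma rkhs_if_bounded_evaluations:
  assumes "\<And>x. \<exists>C\<ge>0. \<forall>f\<in>H. cmod (f x) \<le> C * ip_norm ip f"
  shows "\<exists>K. rkhs H ip K"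
proof -
  have "\<exists>u\<in>H. \<forall>f\<in>H. ip f u = f x" for x
  proof -
    obtain C where C: "0 \<le> C" "\<And>f. f \<in> H \<Longrightarrow> cmod (f x) \<le> C * ip_norm ip f"
      using assms by blast
    let ?R = "{(f, f x) |f. f \<in> H}"
    obtain u where "u \<in> H" "\<And>f l. (f, l) \<in> ?R \<Longrightarrow> ip f u = l"
      by (rule riesz_graph[of ?R C]) (use C zero_in add_in scale_in in auto)
    then show ?thesis by blast
  qed
  then obtain k where k: "\<And>x. k x \<in> H" "\<And>x f. f \<in> H \<Longrightarrow> ip f (k x) = f x" by metis
  have "rkhs H ip (\<lambda>t x. k x t)" using k by unfold_locales (auto simp: eta_contract_eq)
  then show ?thesis by blast
qed

end

section \<open>Spans of kernel functions, kernels of subspaces and row operators\<close>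

definition kernel_sum :: "('x \<Rightarrow> 'x \<Rightarrow> complex) \<Rightarrow> 'x set \<Rightarrow> ('x \<Rightarrow> complex) \<Rightarrow> 'x \<Rightarrow> complex"
  where "kernel_sum K A c = (\<lambda>t. \<Sum>a\<in>A. c a * K t a)"

context rkhs
begin

lemma kernel_sum_in: "finite A \<Longrightarrow> kernel_sum K A c \<in> H"
  unfolding kernel_sum_def by (intro sum_in scale_in kernel_in)

lemma ip_kernel_sum:
  "\<lbrakk>finite A; f \<in> H\<rbrakk> \<Longrightarrow> ip f (kernel_sum K A c) = (\<Sum>a\<in>A. cnj (c a) * f a)"
  unfolding kernel_sum_def by (simp add: ip_sum_right scale_in kernel_in ip_scale_right reproducing)

lemma ip_kernel_sum_self:
  assumes "finite A"
  shows "ip (kernel_sum K A c) (kernel_sum K A c) = (\<Sum>a\<in>A. \<Sum>b\<in>A. cnj (c a) * c b * K a b)"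
  by (simp add: ip_kernel_sum assms kernel_sum_in)
    (simp add: kernel_sum_def sum_distrib_left mult.assoc)

lemma kernel_commute: "K x y = cnj (K y x)"
  using ip_commute[OF kernel_in kernel_in, of y x] by (simp add: reproducing kernel_in)

lemma kernel_self: "K x x = of_real ((ip_norm ip (\<lambda>t. K t x))\<^sup>2)"
  using reproducing[OF kernel_in, of x x] by (simp add: ip_self kernel_in)

lemma kernel_self_nonneg: "0 \<le> Re (K x x)"
  by (simp add: kernel_self)

lemma kernel_self_real: "K x x = of_real (Re (K x x))"
  by (simp add: kernel_self)

lemma evaluation_bounded: "f \<in> H \<Longrightarrow> cmod (f x) \<le> ip_norm ip (\<lambda>t. K t x) * ip_norm ip f"
  using cmod_ip_le[OF _ kernel_in, of f x] by (simp add: reproducing mult.commute)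

text \<open>The inner product of the kernel functions at \<open>x\<close> and \<open>y\<close> is
  the value at \<open>y\<close> of the one at \<open>x\<close>, whence the order of arguments in
  \<open>K y x\<close>.\<close>

lemma rk_dist_eq:
  "rk_dist H ip x y = sqrt (1 - (cmod (K y x))\<^sup>2 / (Re (K x x) * Re (K y y)))"
  unfolding rk_dist_def kernel_fun_def reproducing_kernel_eq
  by (simp add: reproducing kernel_in kernel_self)

lemma rk_dist_defined_iff:
  "rk_dist_defined H ip x y \<longleftrightarrow> 0 < Re (K x x) \<and> 0 < Re (K y y)"
proof -
  have "kernel_fun H ip x \<noteq> 0 \<longleftrightarrow> 0 < Re (K x x)" for x
    unfolding kernel_fun_def reproducing_kernel_eq
    by (simp add: kernel_self kernel_in ip_norm_eq_0)
  then show ?thesis by (simp add: rk_dist_defined_def)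
qed

text \<open>Evaluations on \<open>J\<close> inherit their bounds from \<open>H\<close>.\<close>

lemma closed_subspace_rkhs:
  assumes "closed_subspace H ip J"
  shows "\<exists>L. rkhs J ip L"
proof -
  interpret J: hilbert_function_space J ip using assms by (rule closed_subspace_hilbert)
  have "J \<subseteq> H" using assms by (simp add: closed_subspace_def)
  then show ?thesis
    by (intro J.rkhs_if_bounded_evaluations)
      (meson evaluation_bounded ip_norm_nonneg kernel_in subsetD)
qed

text \<open>The kernel function of \<open>J\<close> is the projection to \<open>J\<close> of that of
  \<open>H\<close>: both reproduce the elements of \<open>J\<close>, so their difference is
  orthogonal to \<open>J\<close>.\<close>

lemma ortho_complement_rkhs:
  assumes J: "closed_subspace H ip J" and L: "rkhs J ip L"
  shows "rkhs (ortho_complement H ip J) ip (\<lambda>x y. K x y - L x y)"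
proof -
  have JH: "J \<subseteq> H" using J by (simp add: closed_subspace_def)
  interpret L: rkhs J ip L by fact
  interpret P: hilbert_function_space "ortho_complement H ip J" ip
    by (intro closed_subspace_hilbert ortho_complement_closed_subspace JH)
  have LH: "(\<lambda>t. L t x) \<in> H" for x using L.kernel_in JH by blast
  have eq: "(\<lambda>t. K t x - L t x) = (\<lambda>t. K t x) - (\<lambda>t. L t x)" for x
    by (simp add: fun_eq_iff)
  have orth: "ip j (\<lambda>t. K t x - L t x) = 0" if "j \<in> J" for j x
    using that JH LH unfolding eq
    by (subst ip_diff_right) (auto simp: kernel_in reproducing L.reproducing)
  show ?thesis
  proof
    fix x
    have KL: "(\<lambda>t. K t x - L t x) \<in> H" unfolding eq by (intro diff_in kernel_in LH)
    then show "(\<lambda>t. K t x - L t x) \<in> ortho_complement H ip J"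
      unfolding ortho_complement_def
      using orth[of _ x] ip_commute[OF KL] JH by auto
    fix f assume "f \<in> ortho_complement H ip J"
    then have f: "f \<in> H" "ip f (\<lambda>t. L t x) = 0"
      using L.kernel_in by (auto simp: ortho_complement_def)
    show "ip f (\<lambda>t. K t x - L t x) = f x"
      unfolding eq using f LH by (simp add: ip_diff_right kernel_in reproducing)
  qed
qed

text \<open>
  The hypothesis on \<open>b\<close> says that the row \<open>(b i)\<^bsub>i<N\<^esub>\<close> has a contractive adjoint on the span of
  the kernel functions.
\<close>

lemma row_contraction:
  fixes b :: "nat \<Rightarrow> 'x \<Rightarrow> complex"
  assumes b: "\<And>A c. finite A \<Longrightarrow> (\<Sum>i<N. (ip_norm ip (kernel_sum K A (\<lambda>a. c a * cnj (b i a))))\<^sup>2)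
      \<le> (ip_norm ip (kernel_sum K A c))\<^sup>2"
    and g: "\<And>i. i < N \<Longrightarrow> g i \<in> H"
  shows "(\<lambda>t. \<Sum>i<N. b i t * g i t) \<in> H"
    and "(ip_norm ip (\<lambda>t. \<Sum>i<N. b i t * g i t))\<^sup>2 \<le> (\<Sum>i<N. (ip_norm ip (g i))\<^sup>2)"
proof -
  define h where "h = (\<lambda>t. \<Sum>i<N. b i t * g i t)"
  define C where "C = L2_set (\<lambda>i. ip_norm ip (g i)) {..<N}"
  \<comment> \<open>If \<open>h\<close> lay in \<open>H\<close>, pairing a kernel sum with it would
    give the second component. Membership of \<open>h\<close> is still open, so \<open>R\<close>
    records the values this functional must take, and Riesz then supplies a candidate for
    \<open>h\<close>.\<close>
  define R where "R = {(kernel_sum K A c, \<Sum>a\<in>A. c a * cnj (h a)) |A c. finite A}"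
  have bound: "cmod l \<le> C * ip_norm ip f" if fl: "(f, l) \<in> R" for f l
  proof -
    obtain A c where A: "finite A" and f: "f = kernel_sum K A c"
      and l: "l = (\<Sum>a\<in>A. c a * cnj (h a))" using fl by (auto simp: R_def)
    define F where "F i = kernel_sum K A (\<lambda>a. c a * cnj (b i a))" for i
    have F: "F i \<in> H" for i using A by (simp add: F_def kernel_sum_in)
    \<comment> \<open>Here \<open>cnj l\<close> becomes the inner product of the tuples
      \<open>g\<close> and \<open>F\<close> in a direct sum of copies of \<open>H\<close>.
      Cauchy-Schwarz is applied in each slot and then to the sequences of norms; \<open>b\<close>
      controls the norm of \<open>F\<close>.\<close>
    have "cnj l = (\<Sum>a\<in>A. \<Sum>i<N. cnj (c a * cnj (b i a)) * g i a)"
      by (simp add: l h_def sum_distrib_left mult.assoc)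
    also have "\<dots> = (\<Sum>i<N. \<Sum>a\<in>A. cnj (c a * cnj (b i a)) * g i a)"
      by (rule sum.swap)
    also have "\<dots> = (\<Sum>i<N. ip (g i) (F i))"
      unfolding F_def using A g by (intro sum.cong refl ip_kernel_sum[symmetric]) auto
    finally have "cmod l = cmod (\<Sum>i<N. ip (g i) (F i))" by (metis complex_mod_cnj)
    also have "\<dots> \<le> (\<Sum>i<N. \<bar>ip_norm ip (g i)\<bar> * \<bar>ip_norm ip (F i)\<bar>)"
      using g F by (intro sum_norm_le) (simp add: cmod_ip_le ip_norm_nonneg)
    also have "\<dots> \<le> C * L2_set (\<lambda>i. ip_norm ip (F i)) {..<N}"
      unfolding C_def by (rule L2_set_mult_ineq)
    also have "\<dots> \<le> C * ip_norm ip f"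
      using b[OF A, of c] A unfolding f C_def L2_set_def F_def
      by (intro mult_left_mono real_le_lsqrt) (auto simp: ip_norm_nonneg kernel_sum_in intro: sum_nonneg)
    finally show ?thesis .
  qed
  obtain u where u: "u \<in> H" "ip_norm ip u \<le> C" "\<And>f l. (f, l) \<in> R \<Longrightarrow> ip f u = l"
  proof (rule riesz_graph[of R C])
    show "(0, 0) \<in> R"
      unfolding R_def by (intro CollectI exI[of _ "{}"]) (simp add: kernel_sum_def zero_fun_def)
  next
    fix f l f' l' assume "(f, l) \<in> R" "(f', l') \<in> R"
    then obtain A c A' c' where A: "finite A" "finite A'"
      and f: "f = kernel_sum K A c" "f' = kernel_sum K A' c'"
      and l: "l = (\<Sum>a\<in>A. c a * cnj (h a))" "l' = (\<Sum>a\<in>A'. c' a * cnj (h a))"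
      by (auto simp: R_def)
    \<comment> \<open>The point sets may overlap, so both coefficient families are extended by zero
      to the union and added.\<close>
    define d where "d a = (if a \<in> A then c a else 0) + (if a \<in> A' then c' a else 0)" for a
    have *: "(\<Sum>a\<in>A \<union> A'. d a * \<phi> a) = (\<Sum>a\<in>A. c a * \<phi> a) + (\<Sum>a\<in>A'. c' a * \<phi> a)" for \<phi>
    proof -
      have "(\<Sum>a\<in>A. c a * \<phi> a) = (\<Sum>a\<in>A \<union> A'. (if a \<in> A then c a else 0) * \<phi> a)"
        using A by (intro sum.mono_neutral_cong_left) auto
      moreover have "(\<Sum>a\<in>A'. c' a * \<phi> a) = (\<Sum>a\<in>A \<union> A'. (if a \<in> A' then c' a else 0) * \<phi> a)"
        using A by (intro sum.mono_neutral_cong_left) auto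
      ultimately show ?thesis by (simp add: d_def distrib_right sum.distrib)
    qed
    have "f + f' = kernel_sum K (A \<union> A') d" "l + l' = (\<Sum>a\<in>A \<union> A'. d a * cnj (h a))"
      unfolding f l kernel_sum_def * by (simp_all add: fun_eq_iff)
    then show "(f + f', l + l') \<in> R" unfolding R_def using A by blast
  next
    fix f l s assume "(f, l) \<in> R"
    then obtain A c where A: "finite A" "f = kernel_sum K A c" "l = (\<Sum>a\<in>A. c a * cnj (h a))"
      by (auto simp: R_def)
    then have "(\<lambda>t. s * f t) = kernel_sum K A (\<lambda>a. s * c a)"
      "s * l = (\<Sum>a\<in>A. (s * c a) * cnj (h a))"
      by (simp_all add: kernel_sum_def fun_eq_iff sum_distrib_left mult.assoc)
    then show "((\<lambda>t. s * f t), s * l) \<in> R" unfolding R_def using A by blast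
  next
    show "f \<in> H" if "(f, l) \<in> R" for f l using that kernel_sum_in by (auto simp: R_def)
  next
    show "cmod l \<le> C * ip_norm ip f" if "(f, l) \<in> R" for f l using that by (rule bound)
    show "0 \<le> C" by (simp add: C_def)
  qed blast
  \<comment> \<open>Testing \<open>u\<close> against a single kernel function recovers its value at
    \<open>x\<close>.\<close>
  have "u x = h x" for x
  proof -
    have "(kernel_sum K {x} (\<lambda>_. 1), \<Sum>a\<in>{x}. 1 * cnj (h a)) \<in> R"
      unfolding R_def by (intro CollectI exI[of _ "{x}"] exI[of _ "\<lambda>_. 1"]) simp
    then have "ip (kernel_sum K {x} (\<lambda>_. 1)) u = (\<Sum>a\<in>{x}. 1 * cnj (h a))" by (rule u(3))
    then have "cnj (u x) = cnj (h x)"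
      using ip_commute[OF kernel_in u(1), of x] u(1) by (simp add: kernel_sum_def reproducing)
    then show ?thesis by simp
  qed
  then have "u = h" by auto
  then show "(\<lambda>t. \<Sum>i<N. b i t * g i t) \<in> H" using u(1) by (simp add: h_def)
  have "(ip_norm ip u)\<^sup>2 \<le> C\<^sup>2" using u(1,2) by (intro power_mono ip_norm_nonneg)
  also have "C\<^sup>2 = (\<Sum>i<N. (ip_norm ip (g i))\<^sup>2)"
    by (simp add: C_def L2_set_def sum_nonneg)
  finally show "(ip_norm ip (\<lambda>t. \<Sum>i<N. b i t * g i t))\<^sup>2 \<le> (\<Sum>i<N. (ip_norm ip (g i))\<^sup>2)"
    using \<open>u = h\<close> by (simp add: h_def)
qed

end

text \<open>Only two points matter: coefficients \<open>Q x y\<close> at \<open>x\<close> and a real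
  \<open>r\<close> at \<open>y\<close> turn the form into a real quadratic polynomial in
  \<open>r\<close> that is never negative.\<close>

lemma positive_definite_Cauchy_Schwarz:
  fixes Q :: "'x \<Rightarrow> 'x \<Rightarrow> complex"
  assumes pos: "\<And>A c. finite A \<Longrightarrow> 0 \<le> Re (\<Sum>a\<in>A. \<Sum>b\<in>A. cnj (c a) * c b * Q a b)"
    and herm: "\<And>x y. Q x y = cnj (Q y x)"
  shows "(cmod (Q x y))\<^sup>2 \<le> Re (Q x x) * Re (Q y y)"
proof -
  have diag: "0 \<le> Re (Q z z)" for z using pos[of "{z}" "\<lambda>_. 1"] by simp
  define n where "n = (cmod (Q x y))\<^sup>2"
  show ?thesis
  \<comment> \<open>Equal points are separated because \<open>{x, y}\<close> would then have only
    one element.\<close>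
  proof (cases "x = y \<or> n = 0")
    case True
    then show ?thesis
    proof
      assume "x = y"
      moreover have "Im (Q x x) = 0" using arg_cong[OF herm[of x x], of Im] by simp
      ultimately show ?thesis by (simp add: cmod_power2) (simp add: power2_eq_square)
    qed (simp add: diag n_def)
  next
    case False
    then have xy: "x \<noteq> y" and n: "0 < n" by (auto simp: n_def)
    have quad: "0 \<le> n * Re (Q x x) + r\<^sup>2 * Re (Q y y) + 2 * r * n" for r
    proof -
      have [simp]: "Re (Q y x) = Re (Q x y)" "Im (Q y x) = - Im (Q x y)" by (simp_all add: herm[of y x])
      have "Im (Q x x) = 0" using arg_cong[OF herm[of x x], of Im] by simp
      then show ?thesis
        using pos[of "{x, y}" "\<lambda>z. if z = x then Q x y else of_real r"] xy
        unfolding n_def cmod_power2 by (simp add: power2_eq_square algebra_simps)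
    qed
    show ?thesis
    \<comment> \<open>With zero leading coefficient the polynomial is affine with slope
      \<open>2 * n\<close>, and a suitable negative \<open>r\<close> contradicts positivity.
      Otherwise \<open>r = - n / Re (Q y y)\<close> is its minimum point.\<close>
    proof (cases "Re (Q y y) = 0")
      case True
      have "n * (Re (Q x x) + 2) \<le> 0"
        using quad[of "- (Re (Q x x) + 1)"] True by (simp add: algebra_simps)
      then show ?thesis using n diag[of x] by (simp add: mult_le_0_iff)
    next
      case False
      then have q: "0 < Re (Q y y)" using diag[of y] by simp
      have "(- n / Re (Q y y))\<^sup>2 * Re (Q y y) = n * (n / Re (Q y y))"
        using q by (simp add: power2_eq_square)
      then have "0 \<le> n * (Re (Q x x) - n / Re (Q y y))"
        using quad[of "- n / Re (Q y y)"] by (simp add: algebra_simps)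
      then have "n / Re (Q y y) \<le> Re (Q x x)" using n by (simp add: zero_le_mult_iff)
      then have "n \<le> Re (Q x x) * Re (Q y y)" using q by (simp add: pos_divide_le_eq)
      then show ?thesis by (simp add: n_def)
    qed
  qed
qed

section \<open>Complete Pick kernels and positivity of the quotient \<open>L / K\<close>\<close>

context rkhs
begin

text \<open>The squared norm for index \<open>i\<close> is the quadratic form of
  \<open>b i x * cnj (b i y) * K x y\<close>; being a finite sum over points, it can be summed over
  \<open>i\<close> termwise.\<close>

lemma kernel_sum_norm_sums:
  assumes A: "finite A" and b: "\<And>x y. (\<lambda>i. b i x * cnj (b i y)) sums \<phi> x y"
  shows "(\<lambda>i. (ip_norm ip (kernel_sum K A (\<lambda>a. c a * cnj (b i a))))\<^sup>2)
    sums Re (\<Sum>x\<in>A. \<Sum>y\<in>A. cnj (c x) * c y * (\<phi> x y * K x y))"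
proof -
  have "(\<lambda>i. Re (\<Sum>x\<in>A. \<Sum>y\<in>A. cnj (c x) * c y * (b i x * cnj (b i y) * K x y)))
    sums Re (\<Sum>x\<in>A. \<Sum>y\<in>A. cnj (c x) * c y * (\<phi> x y * K x y))"
    by (intro sums_Re sums_sum sums_mult sums_mult2 b)
  moreover have "(ip_norm ip (kernel_sum K A (\<lambda>a. c a * cnj (b i a))))\<^sup>2
    = Re (\<Sum>x\<in>A. \<Sum>y\<in>A. cnj (c x) * c y * (b i x * cnj (b i y) * K x y))" for i
    using A by (simp add: ip_norm_power2 kernel_sum_in ip_kernel_sum_self mult_ac)
  ultimately show ?thesis by simp
qed

lemma kernel_sum_norm:
  "finite A \<Longrightarrow> (ip_norm ip (kernel_sum K A c))\<^sup>2 = Re (\<Sum>x\<in>A. \<Sum>y\<in>A. cnj (c x) * c y * K x y)"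
  by (simp add: ip_norm_power2 kernel_sum_in ip_kernel_sum_self)

end

text \<open>Fixes one sequence \<open>b\<close> that witnesses the Pick property, so that the
  following lemmas share it.\<close>

locale complete_pick_rkhs = rkhs +
  fixes b :: "nat \<Rightarrow> 'a \<Rightarrow> complex"
  assumes K_nonzero: "K x y \<noteq> 0"
    and b_sums: "(\<lambda>i. b i x * cnj (b i y)) sums (1 - 1 / K x y)"
begin

text \<open>Since \<open>(1 - 1 / K x y) * K x y = K x y - 1\<close>, the full series of squared
  norms falls short of the right-hand side by the square \<open>(cmod (sum c A))\<^sup>2\<close>.
  Partial sums are smaller still, the terms being nonnegative.\<close>

lemma row_adjoint_contraction:
  assumes A: "finite A"
  shows "(\<Sum>i<N. (ip_norm ip (kernel_sum K A (\<lambda>a. c a * cnj (b i a))))\<^sup>2)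
      \<le> (ip_norm ip (kernel_sum K A c))\<^sup>2"
proof -
  have "(\<Sum>i<N. (ip_norm ip (kernel_sum K A (\<lambda>a. c a * cnj (b i a))))\<^sup>2)
      \<le> Re (\<Sum>x\<in>A. \<Sum>y\<in>A. cnj (c x) * c y * ((1 - 1 / K x y) * K x y))"
    using kernel_sum_norm_sums[of A b "\<lambda>x y. 1 - 1 / K x y" c, OF A b_sums]
      sum_le_suminf[of _ "{..<N}"] unfolding sums_iff by fastforce
  also have "(\<Sum>x\<in>A. \<Sum>y\<in>A. cnj (c x) * c y * ((1 - 1 / K x y) * K x y))
      = (\<Sum>x\<in>A. \<Sum>y\<in>A. cnj (c x) * c y * K x y) - (\<Sum>x\<in>A. \<Sum>y\<in>A. cnj (c x) * c y)"
    by (simp add: sum_subtractf[symmetric] K_nonzero algebra_simps)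
  also have "(\<Sum>x\<in>A. \<Sum>y\<in>A. cnj (c x) * c y) = (\<Sum>x\<in>A. c x) * cnj (\<Sum>x\<in>A. c x)"
    by (simp add: sum_product mult.commute) (rule sum.swap)
  also have "\<dots> = of_real ((cmod (\<Sum>x\<in>A. c x))\<^sup>2)" by (simp only: complex_norm_square)
  finally show ?thesis
    unfolding kernel_sum_norm[OF A, of c] minus_complex.sel Re_complex_of_real
    using zero_le_power2[of "cmod (sum c A)"] by linarith
qed

lemmas row_contraction_b = row_contraction[where b = b, OF row_adjoint_contraction]

text \<open>The row operator is applied to the tuple of length \<open>Suc i\<close> that has
  \<open>f\<close> in slot \<open>i\<close> and zero elsewhere.\<close>

lemma b_multiplier: "multiplier H ip (b i)"
  unfolding multiplier_def
proof (intro conjI ballI exI)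
  fix f assume f: "f \<in> H"
  let ?g = "\<lambda>j. if j = i then f else 0"
  have g: "?g j \<in> H" for j using f zero_in by simp
  have eq: "(\<lambda>t. \<Sum>j<Suc i. b j t * ?g j t) = b i * f"
    by (simp add: fun_eq_iff)
  have "(\<lambda>t. \<Sum>j<Suc i. b j t * ?g j t) \<in> H" by (intro row_contraction_b(1) g)
  then show mem: "b i * f \<in> H" by (simp only: eq)
  have "(ip_norm ip (\<lambda>t. \<Sum>j<Suc i. b j t * ?g j t))\<^sup>2 \<le> (\<Sum>j<Suc i. (ip_norm ip (?g j))\<^sup>2)"
    by (intro row_contraction_b(2) g)
  also have "\<dots> = (ip_norm ip f)\<^sup>2"
    using zero_in by (simp add: ip_norm_eq_0)
  finally show "ip_norm ip (b i * f) \<le> 1 * ip_norm ip f"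
    unfolding eq using power2_le_imp_le[OF _ ip_norm_nonneg[OF f]] by simp
qed

text \<open>
  The row operator maps \<open>J\<^sup>N\<close> into \<open>J\<close>; testing its value at the vector of the
  \<open>kernel_sum L A (\<lambda>a. c a * cnj (b i a))\<close> against \<open>kernel_sum L A c\<close> gives the sum of squared norms.
\<close>

lemma subspace_row_adjoint_contraction:
  assumes J: "closed_subspace H ip J" and inv: "multiplier_invariant H ip J"
    and L: "rkhs J ip L" and A: "finite A"
  shows "(\<Sum>i<N. (ip_norm ip (kernel_sum L A (\<lambda>a. c a * cnj (b i a))))\<^sup>2)
      \<le> (ip_norm ip (kernel_sum L A c))\<^sup>2"
proof -
  interpret L: rkhs J ip L by fact
  have JH: "J \<subseteq> H" using J by (simp add: closed_subspace_def)
  define g where "g i = kernel_sum L A (\<lambda>a. c a * cnj (b i a))" for i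
  define F where "F = kernel_sum L A c"
  define S where "S = (\<lambda>t. \<Sum>i<N. b i t * g i t)"
  define q where "q = (\<Sum>i<N. (ip_norm ip (g i))\<^sup>2)"
  have g: "g i \<in> J" for i using A by (simp add: g_def L.kernel_sum_in)
  have F: "F \<in> J" using A by (simp add: F_def L.kernel_sum_in)
  have "(\<lambda>t. b i t * g i t) \<in> J" for i
    using inv b_multiplier[of i] g[of i] by (auto simp: multiplier_invariant_def times_fun_def)
  then have S: "S \<in> J" unfolding S_def by (intro L.sum_in) auto
  have "ip S F = (\<Sum>a\<in>A. cnj (c a) * S a)"
    unfolding F_def using A S by (rule L.ip_kernel_sum)
  also have "\<dots> = (\<Sum>a\<in>A. \<Sum>i<N. cnj (c a * cnj (b i a)) * g i a)"
    by (simp add: S_def sum_distrib_left mult.assoc)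
  also have "\<dots> = (\<Sum>i<N. \<Sum>a\<in>A. cnj (c a * cnj (b i a)) * g i a)"
    by (rule sum.swap)
  also have "\<dots> = (\<Sum>i<N. ip (g i) (g i))"
    using L.ip_kernel_sum[OF A g] by (simp add: g_def)
  also have "\<dots> = of_real q" using g by (simp add: L.ip_self q_def)
  finally have SF: "ip S F = of_real q" .
  have q: "0 \<le> q" by (simp add: q_def sum_nonneg)
  have "q = cmod (ip S F)" using q by (simp add: SF)
  also have "\<dots> \<le> ip_norm ip S * ip_norm ip F" using S F by (rule L.cmod_ip_le)
  \<comment> \<open>The contraction property bounds the squared norm of \<open>S\<close> by
    \<open>q\<close> again, so one factor \<open>q\<close> cancels.\<close>
  finally have "q\<^sup>2 \<le> (ip_norm ip S)\<^sup>2 * (ip_norm ip F)\<^sup>2"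
    using q by (metis power_mono power_mult_distrib)
  also have "\<dots> \<le> q * (ip_norm ip F)\<^sup>2"
    using g JH unfolding S_def q_def by (intro mult_right_mono row_contraction_b(2)) auto
  finally have "q \<le> (ip_norm ip F)\<^sup>2"
    using q by (cases "q = 0") (auto simp: power2_eq_square)
  then show ?thesis by (simp add: q_def g_def F_def)
qed

text \<open>The contraction estimate for \<open>J\<close> holds for every \<open>N\<close>, hence in
  the limit; what remains is the form of \<open>L - (1 - 1 / K) * L\<close>, which is
  \<open>L / K\<close>.\<close>

lemma quotient_positive_definite:
  assumes J: "closed_subspace H ip J" and inv: "multiplier_invariant H ip J"
    and L: "rkhs J ip L" and A: "finite A"
  shows "0 \<le> Re (\<Sum>x\<in>A. \<Sum>y\<in>A. cnj (c x) * c y * (L x y / K x y))"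
proof -
  interpret L: rkhs J ip L by fact
  have "Re (\<Sum>x\<in>A. \<Sum>y\<in>A. cnj (c x) * c y * ((1 - 1 / K x y) * L x y))
      \<le> (ip_norm ip (kernel_sum L A c))\<^sup>2"
    using L.kernel_sum_norm_sums[of A b "\<lambda>x y. 1 - 1 / K x y" c, OF A b_sums] unfolding sums_def
    by (rule LIMSEQ_le_const2) (use subspace_row_adjoint_contraction[OF J inv L A] in blast)
  also have "\<dots> = Re (\<Sum>x\<in>A. \<Sum>y\<in>A. cnj (c x) * c y * L x y)"
    using A by (rule L.kernel_sum_norm)
  finally show ?thesis
    by (simp add: left_diff_distrib right_diff_distrib sum_subtractf)
qed

end

text \<open>With \<open>m\<close> the geometric mean of \<open>r\<close> and \<open>s\<close>, the
  inequality \<open>2 * m \<le> r + s\<close> bounds the left side by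
  \<open>(1 - m)\<^sup>2\<close>, while \<open>cmod (1 - q)\<close> is at least
  \<open>1 - cmod q\<close> and so at least \<open>1 - m\<close>.\<close>

lemma one_minus_Cauchy_Schwarz:
  fixes q :: complex
  assumes "(cmod q)\<^sup>2 \<le> r * s" "0 \<le> r" "r \<le> 1" "0 \<le> s" "s \<le> 1"
  shows "(1 - r) * (1 - s) \<le> (cmod (1 - q))\<^sup>2"
proof -
  define m where "m = sqrt (r * s)"
  have m: "m\<^sup>2 = r * s" "0 \<le> m" using assms by (simp_all add: m_def)
  have m1: "m \<le> 1" using assms by (simp add: m_def mult_le_one)
  have "cmod q \<le> m" using assms(1) unfolding m_def by (rule real_le_rsqrt)
  have "(2 * m)\<^sup>2 \<le> (r + s)\<^sup>2"
    using zero_le_power2[of "r - s"] m(1) by (simp add: power2_sum power2_diff power_mult_distrib)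
  then have "2 * m \<le> r + s" by (rule power2_le_imp_le) (simp add: assms)
  moreover have "(1 - r) * (1 - s) = 1 - r - s + m\<^sup>2" unfolding m(1) by (simp add: algebra_simps)
  ultimately have "(1 - r) * (1 - s) \<le> (1 - m)\<^sup>2" by (simp add: power2_diff)
  also have "\<dots> \<le> (cmod (1 - q))\<^sup>2"
    using m1 \<open>cmod q \<le> m\<close> norm_triangle_ineq2[of 1 q] by (intro power_mono) simp_all
  finally show ?thesis .
qed

section \<open>Comparison of the three distances\<close>

theorem corollary5:
  fixes H J :: "('x \<Rightarrow> complex) set"
    and ip :: "('x \<Rightarrow> complex) \<Rightarrow> ('x \<Rightarrow> complex) \<Rightarrow> complex"
    and K :: "'x \<Rightarrow> 'x \<Rightarrow> complex"
    and \<omega> :: 'x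
  assumes "rkhs H ip K"
    and "complete_pick_kernel K"
    and "\<forall>x. K \<omega> x = 1 \<and> K x \<omega> = 1"
    and "closed_subspace H ip J"
    and "multiplier_invariant H ip J"
  shows "\<forall>x y.
      (rk_dist_defined J ip x y \<and> rk_dist_defined H ip x y \<longrightarrow>
        rk_dist J ip x y \<ge> rk_dist H ip x y) \<and>
      (rk_dist_defined H ip x y \<and> rk_dist_defined (ortho_complement H ip J) ip x y \<longrightarrow>
        rk_dist H ip x y \<ge> rk_dist (ortho_complement H ip J) ip x y)"
proof (intro allI)
  fix x y
  interpret rkhs H ip K by fact
  obtain b :: "nat \<Rightarrow> 'x \<Rightarrow> complex"
    where "\<forall>x y. K x y \<noteq> 0" "\<forall>x y. (\<lambda>i. b i x * cnj (b i y)) sums (1 - 1 / K x y)"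
    using assms(2) unfolding complete_pick_kernel_def by blast
  then interpret complete_pick_rkhs H ip K b by unfold_locales blast+
  obtain L where L: "rkhs J ip L" using closed_subspace_rkhs assms(4) by blast
  interpret L: rkhs J ip L by fact
  interpret P: rkhs "ortho_complement H ip J" ip "\<lambda>x y. K x y - L x y"
    using assms(4) L by (rule ortho_complement_rkhs)
  define Q where "Q x y = L x y / K x y" for x y
  have Q_herm: "Q x y = cnj (Q y x)" for x y
    unfolding Q_def complex_cnj_divide
    using L.kernel_commute[of x y] kernel_commute[of x y] by (rule arg_cong2)
  have Q_pos: "0 \<le> Re (\<Sum>x\<in>A. \<Sum>y\<in>A. cnj (c x) * c y * Q x y)" if "finite A" for A c
    unfolding Q_def using assms(4,5) L that by (rule quotient_positive_definite)
  have CS: "(cmod (Q y x))\<^sup>2 \<le> Re (Q x x) * Re (Q y y)"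
    using positive_definite_Cauchy_Schwarz[of Q y x, OF Q_pos Q_herm] by (simp only: mult.commute)
  have L_eq: "L x y = Q x y * K x y" for x y by (simp add: Q_def K_nonzero)
  \<comment> \<open>The diagonal is real and nonnegative, and a Pick kernel never vanishes.\<close>
  have K_pos: "0 < Re (K z z)" for z
    using kernel_self_nonneg[of z] K_nonzero[of z z] arg_cong[OF kernel_self_real[of z], of Im]
    by (auto simp: complex_eq_iff less_le)
  have Re_L: "Re (L z z) = Re (Q z z) * Re (K z z)" for z
    using arg_cong[OF kernel_self_real[of z], of Im] by (simp add: L_eq)
  \<comment> \<open>The diagonals of the two kernels \<open>L\<close> and \<open>K - L\<close> are
    nonnegative, which confines that of \<open>Q\<close> to the unit interval.\<close>
  have Q_nonneg: "0 \<le> Re (Q z z)" for z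
    using L.kernel_self_nonneg[of z] K_pos[of z] by (simp add: Re_L zero_le_mult_iff)
  have Q_le: "Re (Q z z) \<le> 1" for z
    using P.kernel_self_nonneg[of z] K_pos[of z] by (simp add: Re_L)
  let ?k = "(cmod (K y x))\<^sup>2 / (Re (K x x) * Re (K y y))"
  show "(rk_dist_defined J ip x y \<and> rk_dist_defined H ip x y \<longrightarrow>
        rk_dist J ip x y \<ge> rk_dist H ip x y) \<and>
      (rk_dist_defined H ip x y \<and> rk_dist_defined (ortho_complement H ip J) ip x y \<longrightarrow>
        rk_dist H ip x y \<ge> rk_dist (ortho_complement H ip J) ip x y)"
  proof (intro conjI impI; elim conjE)
    assume "rk_dist_defined J ip x y"
    then have pos: "0 < Re (L x x)" "0 < Re (L y y)" by (simp_all add: L.rk_dist_defined_iff)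
    then have Q: "0 < Re (Q x x)" "0 < Re (Q y y)"
      using K_pos[of x] K_pos[of y] by (simp_all add: Re_L zero_less_mult_iff)
    \<comment> \<open>Passing from \<open>H\<close> to \<open>J\<close> multiplies the ratio under
      the root by a factor built from \<open>Q\<close>, at most 1 by \<open>CS\<close>; a smaller
      ratio means a larger distance.\<close>
    have "(cmod (L y x))\<^sup>2 / (Re (L x x) * Re (L y y))
        = (cmod (Q y x))\<^sup>2 / (Re (Q x x) * Re (Q y y)) * ?k"
      by (simp add: Re_L L_eq[of y x] norm_mult power_mult_distrib mult_ac)
    also have "\<dots> \<le> 1 * ?k"
      using CS Q K_pos[of x] K_pos[of y] by (intro mult_right_mono) simp_all
    finally show "rk_dist H ip x y \<le> rk_dist J ip x y" by (simp add: rk_dist_eq L.rk_dist_eq)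
  next
    assume "rk_dist_defined (ortho_complement H ip J) ip x y"
    then have "0 < Re (K x x - L x x)" "0 < Re (K y y - L y y)"
      by (simp_all only: P.rk_dist_defined_iff)
    then have Q: "Re (Q x x) < 1" "Re (Q y y) < 1"
      using K_pos[of x] K_pos[of y] by (simp_all add: Re_L)
    \<comment> \<open>For the complement the factor is built from \<open>1 - Q\<close> and is at
      least 1; definedness of its distance makes the denominator positive.\<close>
    have "1 * ?k \<le> (cmod (1 - Q y x))\<^sup>2 / ((1 - Re (Q x x)) * (1 - Re (Q y y))) * ?k"
      using one_minus_Cauchy_Schwarz[OF CS Q_nonneg Q_le Q_nonneg Q_le] Q K_pos[of x] K_pos[of y]
      by (intro mult_right_mono) simp_all
    also have "\<dots> = (cmod ((1 - Q y x) * K y x))\<^sup>2 /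
        (((1 - Re (Q x x)) * Re (K x x)) * ((1 - Re (Q y y)) * Re (K y y)))"
      by (simp add: norm_mult power_mult_distrib mult_ac)
    also have "\<dots> = (cmod (K y x - L y x))\<^sup>2 / (Re (K x x - L x x) * Re (K y y - L y y))"
      by (simp add: Re_L L_eq[of y x] left_diff_distrib)
    finally show "rk_dist (ortho_complement H ip J) ip x y \<le> rk_dist H ip x y"
      by (simp add: rk_dist_eq P.rk_dist_eq)
  qed
qed

end
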